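(* Let $\tau=\tau_{l_1,l_2,l_3}^{m,s}$ be a complex-valued function of $(l_1,l_2,l_3,m,s)\in\mathbb{Z}^5$ satisfying, at every lattice point, the three bilinear difference equations $$\tau_{l_i+1}^{m+1}\,\tau-\tau_{l_i+1}\,\tau^{m+1}=\tau_{l_i+1}^{s+1}\,\tau^{m+1,s-1}\qquad(i=1,2,3).$$ Then, for any fixed $m,s$, the function $$z_{l_1,l_2,l_3}=\frac{\tau_{l_1,l_2,l_3}^{m+1,s}}{\tau_{l_1,l_2,l_3}^{m,s}}$$ satisfies the discrete Schwarzian KP equation $$\frac{(z_{l_1+1}-z_{l_1+1,l_2+1})(z_{l_2+1}-z_{l_2+1,l_3+1})(z_{l_3+1}-z_{l_1+1,l_3+1})}{(z_{l_1+1,l_2+1}-z_{l_2+1})(z_{l_2+1,l_3+1}-z_{l_3+1})(z_{l_1+1,l_3+1}-z_{l_1+1})}=-1 .$$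
   Context: Notation: only shifted independent variables are displayed. For example $\tau=\tau_{l_1,l_2,l_3}^{m,s}$, $\tau_{l_1+1}^{m+1}=\tau_{l_1+1,l_2,l_3}^{m+1,s}$, $\tau^{m+1,s-1}=\tau_{l_1,l_2,l_3}^{m+1,s-1}$, $\tau_{l_i+1}^{s+1}$ is $\tau$ with $l_i$ and $s$ each raised by one; similarly $z_{l_1+1,l_2+1}=z_{l_1+1,l_2+1,l_3}$, etc. Quantities appearing in denominators ($\tau$, and the differences of $z$ in the denominator of the equation) are understood to be nonzero. *)

theory Defs
  imports Complex_Main
begin

type_synonym lattice3_fun = "int \<Rightarrow> int \<Rightarrow> int \<Rightarrow> complex"

(* Argument order: l1, l2, l3, m, s. *)
type_synonym lattice5_fun = "int \<Rightarrow> int \<Rightarrow> int \<Rightarrow> int \<Rightarrow> int \<Rightarrow> complex"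

definition bilinear_system :: "lattice5_fun \<Rightarrow> bool" where
  "bilinear_system \<tau> \<longleftrightarrow> (\<forall>l1 l2 l3 m s.
     \<tau> (l1+1) l2 l3 (m+1) s * \<tau> l1 l2 l3 m s - \<tau> (l1+1) l2 l3 m s * \<tau> l1 l2 l3 (m+1) s
       = \<tau> (l1+1) l2 l3 m (s+1) * \<tau> l1 l2 l3 (m+1) (s-1) \<and>
     \<tau> l1 (l2+1) l3 (m+1) s * \<tau> l1 l2 l3 m s - \<tau> l1 (l2+1) l3 m s * \<tau> l1 l2 l3 (m+1) s
       = \<tau> l1 (l2+1) l3 m (s+1) * \<tau> l1 l2 l3 (m+1) (s-1) \<and>
     \<tau> l1 l2 (l3+1) (m+1) s * \<tau> l1 l2 l3 m s - \<tau> l1 l2 (l3+1) m s * \<tau> l1 l2 l3 (m+1) s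
       = \<tau> l1 l2 (l3+1) m (s+1) * \<tau> l1 l2 l3 (m+1) (s-1))"

definition tau_ratio :: "lattice5_fun \<Rightarrow> int \<Rightarrow> int \<Rightarrow> lattice3_fun" where
  "tau_ratio \<tau> m s = (\<lambda>l1 l2 l3. \<tau> l1 l2 l3 (m+1) s / \<tau> l1 l2 l3 m s)"

definition dSKP_numerator :: "lattice3_fun \<Rightarrow> lattice3_fun" where
  "dSKP_numerator z l1 l2 l3 =
     (z (l1+1) l2 l3 - z (l1+1) (l2+1) l3) *
     (z l1 (l2+1) l3 - z l1 (l2+1) (l3+1)) *
     (z l1 l2 (l3+1) - z (l1+1) l2 (l3+1))"

definition dSKP_denominator :: "lattice3_fun \<Rightarrow> lattice3_fun" where
  "dSKP_denominator z l1 l2 l3 =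
     (z (l1+1) (l2+1) l3 - z l1 (l2+1) l3) *
     (z l1 (l2+1) (l3+1) - z l1 l2 (l3+1)) *
     (z (l1+1) l2 (l3+1) - z (l1+1) l2 l3)"

end

theory Submission
  imports Defs
begin

text \<open>Divided by $\tau\,\tau_{l_i+1}$, each bilinear equation says that the difference of $z$ along an
  edge of the lattice is a product of a factor at its upper endpoint and a factor at its lower endpoint.
  The six edges in the equation form a hexagon, and the numerator and the denominator
  use the same endpoint factors, so everything cancels except three signs.\<close>

lemma hexagon_numerator_eq_neg_denominator:
  fixes z p q :: "int \<Rightarrow> int \<Rightarrow> int \<Rightarrow> complex"
  assumes "\<And>l1 l2 l3. z (l1+1) l2 l3 - z l1 l2 l3 = p (l1+1) l2 l3 * q l1 l2 l3"
    and "\<And>l1 l2 l3. z l1 (l2+1) l3 - z l1 l2 l3 = p l1 (l2+1) l3 * q l1 l2 l3"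
    and "\<And>l1 l2 l3. z l1 l2 (l3+1) - z l1 l2 l3 = p l1 l2 (l3+1) * q l1 l2 l3"
  shows "dSKP_numerator z l1 l2 l3 = - dSKP_denominator z l1 l2 l3"
proof -
  \<comment> \<open>These edges are taken as lower minus upper endpoint, against the orientation in
    the assumptions; those of the denominator follow it.\<close>
  have "z (l1+1) l2 l3 - z (l1+1) (l2+1) l3 = - (p (l1+1) (l2+1) l3 * q (l1+1) l2 l3)"
    and "z l1 (l2+1) l3 - z l1 (l2+1) (l3+1) = - (p l1 (l2+1) (l3+1) * q l1 (l2+1) l3)"
    and "z l1 l2 (l3+1) - z (l1+1) l2 (l3+1) = - (p (l1+1) l2 (l3+1) * q l1 l2 (l3+1))"
    by (simp_all flip: assms)
  then show ?thesis
    unfolding dSKP_numerator_def dSKP_denominator_def by (simp add: assms)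
qed

text \<open>Here \<open>a / b\<close> is the value of z at the upper endpoint of an edge,
  \<open>c / d\<close> the value at the lower one.\<close>

lemma ratio_diff_eq:
  fixes a b c d p q :: complex
  assumes "a * d - b * c = p * q" and "b \<noteq> 0" and "d \<noteq> 0"
  shows "a / b - c / d = (p / b) * (q / d)"
  using assms by (simp add: diff_frac_eq mult.commute)

theorem proposition2p1:
  fixes \<tau> :: "int \<Rightarrow> int \<Rightarrow> int \<Rightarrow> int \<Rightarrow> int \<Rightarrow> complex" and m s :: int
  assumes "bilinear_system \<tau>"
    and "\<forall>l1 l2 l3. \<tau> l1 l2 l3 m s \<noteq> 0"
  shows "\<forall>l1 l2 l3. dSKP_denominator (tau_ratio \<tau> m s) l1 l2 l3 \<noteq> 0 \<longrightarrow>
     dSKP_numerator (tau_ratio \<tau> m s) l1 l2 l3 / dSKP_denominator (tau_ratio \<tau> m s) l1 l2 l3 = -1"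
proof -
  \<comment> \<open>The same \<open>p\<close> and \<open>q\<close> serve all three directions: on
    the right of each bilinear equation, the factor with s+1 sits at the shifted point and the other
    at the base point.\<close>
  define p where "p l1 l2 l3 = \<tau> l1 l2 l3 m (s+1) / \<tau> l1 l2 l3 m s" for l1 l2 l3
  define q where "q l1 l2 l3 = \<tau> l1 l2 l3 (m+1) (s-1) / \<tau> l1 l2 l3 m s" for l1 l2 l3
  have "dSKP_numerator (tau_ratio \<tau> m s) l1 l2 l3 = - dSKP_denominator (tau_ratio \<tau> m s) l1 l2 l3"
    for l1 l2 l3
    by (rule hexagon_numerator_eq_neg_denominator[of _ p q];
        unfold tau_ratio_def p_def q_def; rule ratio_diff_eq)
      (use assms in \<open>simp_all add: bilinear_system_def\<close>)
  then show ?thesis by simp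
qed

end
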